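(* Let $m>1$ be an integer and let $p$ be a prime with $p\equiv 1 \pmod m$. Let $R_m$ denote the set of integers $k$ with $1\le k\le p-1$ that are $m$th power residues modulo $p$ (i.e. $k\equiv x^m \pmod p$ for some integer $x$). Let $f:[0,1]\to\mathbb{R}$ be a function whose Fourier series converges pointwise to $f$ on $(0,1)$, say \[f(x)=\sum_{n=-\infty}^{\infty}a_n e^{2\pi i n x}\quad (0<x<1),\] and suppose that $S(f)=\sum_{n\neq 0}|a_n|$ converges. Then \[\left|\sum_{k\in R_m} f\!\left(\frac{k}{p}\right)-\frac{1}{m}\sum_{k=1}^{p-1} f\!\left(\frac{k}{p}\right)\right|\le \left(1-\frac{1}{m}\right)S(f)\sqrt{p}.\] *)

theory Defs
  imports "HOL-Analysis.Analysis" "HOL-Number_Theory.Number_Theory"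
begin

definition power_residues :: "nat \<Rightarrow> nat \<Rightarrow> int set" where
  "power_residues m p =
     {k. 1 \<le> k \<and> k \<le> int p - 1 \<and> (\<exists>x::int. [k = x ^ m] (mod int p))}"

text \<open>Only the values of \<open>f\<close> on the unit interval enter the definitions below.\<close>

definition fourier_coeff :: "(real \<Rightarrow> real) \<Rightarrow> int \<Rightarrow> complex" where
  "fourier_coeff f n =
     integral {0..1} (\<lambda>x. of_real (f x) * exp (- (2 * of_real pi * \<i> * of_int n * of_real x)))"

definition fourier_partial_sum :: "(real \<Rightarrow> real) \<Rightarrow> nat \<Rightarrow> real \<Rightarrow> complex" where
  "fourier_partial_sum f N x =
     (\<Sum>n = - int N..int N. fourier_coeff f n * exp (2 * of_real pi * \<i> * of_int n * of_real x))"

definition fourier_S :: "(real \<Rightarrow> real) \<Rightarrow> real" where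
  "fourier_S f = (\<Sum>\<^sub>\<infinity>n\<in>- {0}. norm (fourier_coeff f n))"

end

theory Submission
  imports Defs
begin

text \<open>
  Write \<open>e(t) = exp(2\<pi>it)\<close> and let \<open>g\<close> be a primitive root modulo \<open>p\<close>. Since \<open>m\<close> divides
  \<open>p - 1\<close>, the residue \<open>g\<^sup>j\<close> is an \<open>m\<close>th power iff \<open>m\<close> divides \<open>j\<close>, and the weight
  \<open>[m dvd j] - 1/m\<close> is \<open>1/m\<close> times the sum over \<open>0 < r < m\<close> of the nontrivial
  characters \<open>g\<^sup>j \<mapsto> e(rj/m)\<close>. Inserting the Fourier series of \<open>f\<close>, the left-hand side becomes
  a combination of the \<open>a\<^sub>n\<close> with \<open>n \<noteq> 0\<close> whose coefficients are \<open>1/m\<close> times sums of \<open>m - 1\<close>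
  Gauss sums. Each Gauss sum has modulus at most \<open>\<surd>p\<close>: as a function of \<open>n\<close> its modulus is
  constant on the units and zero at \<open>0\<close>, so Parseval's identity modulo \<open>p\<close> determines it.
\<close>

section \<open>Additive characters and their orthogonality\<close>

definition unit_root :: "nat \<Rightarrow> int \<Rightarrow> complex" where
  "unit_root n a = cis (2 * pi * of_int a / of_nat n)"

lemma unit_root_0 [simp]: "unit_root n 0 = 1"
  by (simp add: unit_root_def)

lemma norm_unit_root [simp]: "norm (unit_root n a) = 1"
  by (simp add: unit_root_def)

lemma unit_root_add: "unit_root n (a + b) = unit_root n a * unit_root n b"
  by (simp add: unit_root_def cis_mult add_divide_distrib ring_distribs)

lemma cnj_unit_root: "cnj (unit_root n a) = unit_root n (- a)"
  by (simp add: unit_root_def cis_cnj)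

lemma unit_root_power: "unit_root n a ^ k = unit_root n (int k * a)"
  by (induction k) (simp_all add: unit_root_add ring_distribs)

lemma unit_root_eq_1_iff:
  assumes "n > 0"
  shows "unit_root n a = 1 \<longleftrightarrow> int n dvd a"
proof -
  have "unit_root n a = exp (\<i> * of_real (2 * pi * of_int a / of_nat n))"
    by (simp add: unit_root_def cis_conv_exp)
  also have "\<dots> = 1 \<longleftrightarrow> (\<exists>k::int. 2 * pi * of_int a / of_nat n = of_int (2 * k) * pi)"
    by (simp add: exp_eq_1)
  also have "\<dots> \<longleftrightarrow> (\<exists>k::int. real_of_int a = real_of_int (int n * k))"
    using assms by (intro ex_cong1) (auto simp: field_simps)
  also have "\<dots> \<longleftrightarrow> int n dvd a"
    unfolding of_int_eq_iff dvd_def ..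
  finally show ?thesis .
qed

lemma unit_root_cong:
  assumes "n > 0" "[a = b] (mod int n)"
  shows "unit_root n a = unit_root n b"
proof -
  have "unit_root n (a - b) = 1"
    using assms by (simp add: unit_root_eq_1_iff cong_iff_dvd_diff)
  then show ?thesis
    using unit_root_add[of n "a - b" b] by simp
qed

lemma sum_powers_root_of_unity:
  fixes z :: "'a::field"
  assumes "z ^ n = 1" "z \<noteq> 1"
  shows "(\<Sum>j<n. z ^ j) = 0"
  using assms by (simp add: geometric_sum)

text \<open>Orthogonality of additive characters. It is used modulo \<open>p\<close> to isolate the
  diagonal in Parseval's identity, and modulo \<open>m\<close> to detect the multiples of
  \<open>m\<close>.\<close>

lemma sum_unit_root:
  assumes "n > 0"
  shows "(\<Sum>k<n. unit_root n (int k * d)) = (if int n dvd d then of_nat n else 0)"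
proof (cases "int n dvd d")
  case True
  then have "unit_root n (int k * d) = 1" for k
    using assms by (simp add: unit_root_eq_1_iff)
  then show ?thesis using True by simp
next
  case False
  then have "(\<Sum>k<n. unit_root n d ^ k) = 0"
    using assms by (intro sum_powers_root_of_unity) (simp_all add: unit_root_power unit_root_eq_1_iff)
  then show ?thesis using False by (simp add: unit_root_power)
qed

section \<open>Gauss sums and their modulus\<close>

text \<open>For \<open>g\<close> a primitive root modulo the prime \<open>p\<close>, this is the Gauss sum, twisted by \<open>n\<close>, of
  the multiplicative character sending \<open>g\<close> to \<open>z\<close>.\<close>

definition gauss_sum :: "nat \<Rightarrow> nat \<Rightarrow> complex \<Rightarrow> int \<Rightarrow> complex" where
  "gauss_sum p g z n = (\<Sum>j<p - 1. z ^ j * unit_root p (n * int g ^ j))"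

lemma gauss_sum_cong:
  assumes "p > 0" "[a = b] (mod int p)"
  shows "gauss_sum p g z a = gauss_sum p g z b"
  unfolding gauss_sum_def
  by (intro sum.cong refl arg_cong2[where f = "(*)"] unit_root_cong)
     (use assms in \<open>auto intro: cong_mult\<close>)

text \<open>The additive factors all become 1, which leaves a full geometric sum over a nontrivial
  root of unity.\<close>

lemma gauss_sum_dvd:
  assumes "p > 0" "z ^ (p - 1) = 1" "z \<noteq> 1" "int p dvd n"
  shows "gauss_sum p g z n = 0"
proof -
  have "gauss_sum p g z n = gauss_sum p g z 0"
    using assms by (intro gauss_sum_cong) (auto simp: cong_0_iff)
  also have "\<dots> = (\<Sum>j<p - 1. z ^ j)"
    by (simp add: gauss_sum_def)
  also have "\<dots> = 0"
    using assms by (intro sum_powers_root_of_unity)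
  finally show ?thesis .
qed

context
  fixes p g :: nat
  assumes p: "prime p" and g: "residue_primroot p g"
begin

lemma p_pos: "p > 0"
  using p by (rule prime_gt_0_nat)

lemma bij_betw_primroot_powers: "bij_betw (\<lambda>j. g ^ j mod p) {..<p - 1} {1..p - 1}"
proof -
  have "totatives p = {1..p - 1}"
    using totatives_prime[OF p] by auto
  then show ?thesis
    using residue_primroot_is_generator[OF _ g] prime_gt_1_nat[OF p] totient_prime[OF p] by simp
qed

lemma ex_primroot_power_cong:
  assumes "\<not> int p dvd n"
  obtains i where "i < p - 1" "[n = int g ^ i] (mod int p)"
proof -
  have "n mod int p \<noteq> 0" "n mod int p \<ge> 0" "n mod int p < int p"
    using assms p_pos by (auto simp: dvd_eq_mod_eq_0)
  then have "nat (n mod int p) \<in> {1..p - 1}"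
    by auto
  then have "nat (n mod int p) \<in> (\<lambda>j. g ^ j mod p) ` {..<p - 1}"
    using bij_betw_imp_surj_on[OF bij_betw_primroot_powers] by simp
  then obtain i where i: "i < p - 1" "nat (n mod int p) = g ^ i mod p"
    by auto
  then have "int (nat (n mod int p)) = int (g ^ i mod p)"
    by simp
  then have "n mod int p = int g ^ i mod int p"
    using \<open>n mod int p \<ge> 0\<close> by (simp add: of_nat_mod)
  with i show ?thesis
    by (intro that[of i]) (auto simp: cong_def)
qed

lemma primroot_power_cong_iff:
  "[int g ^ i = int g ^ j] (mod int p) \<longleftrightarrow> [i = j] (mod (p - 1))"
proof -
  have "[int g ^ i = int g ^ j] (mod int p) \<longleftrightarrow> [g ^ i = g ^ j] (mod p)"
    by (metis cong_int_iff of_nat_power)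
  also have "\<dots> \<longleftrightarrow> [i = j] (mod ord p g)"
    using g by (intro order_divides_expdiff) (auto simp: residue_primroot_def)
  also have "ord p g = p - 1"
    using g totient_prime[OF p] by (auto simp: residue_primroot_def)
  finally show ?thesis .
qed

text \<open>The left side is the same sum with \<open>j\<close> shifted to \<open>j + 1\<close>. The
  summand has period \<open>p - 1\<close> in \<open>j\<close>, because both \<open>z\<close> and
  \<open>g\<close> modulo \<open>p\<close> have trivial power \<open>p - 1\<close>, so the shift
  only permutes the terms cyclically.\<close>

lemma gauss_sum_mult_primroot:
  assumes "z ^ (p - 1) = 1"
  shows "z * gauss_sum p g z (n * int g) = gauss_sum p g z n"
proof -
  define h where "h j = z ^ j * unit_root p (n * int g ^ j)" for j
  have "z * gauss_sum p g z (n * int g) = (\<Sum>j<p - 1. h (Suc j))"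
    by (simp add: gauss_sum_def h_def sum_distrib_left mult_ac)
  also have "\<dots> = (\<Sum>j<p - 1. h j) + (h (p - 1) - h 0)"
    using sum.lessThan_Suc_shift[of h "p - 1"] by (simp add: algebra_simps)
  also have "h (p - 1) = h 0"
  proof -
    have "[int g ^ (p - 1) = int g ^ 0] (mod int p)"
      unfolding primroot_power_cong_iff by (simp add: cong_def)
    then have "unit_root p (n * int g ^ (p - 1)) = unit_root p (n * int g ^ 0)"
      using p_pos by (intro unit_root_cong cong_mult) auto
    then show ?thesis using assms by (simp add: h_def)
  qed
  finally show ?thesis by (simp add: gauss_sum_def h_def)
qed

text \<open>As \<open>z\<close> has modulus 1, the shift identity says that multiplying the argument
  by \<open>g\<close> preserves the modulus.\<close>

lemma norm_gauss_sum_primroot_power: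
  assumes "z ^ (p - 1) = 1" "norm z = 1"
  shows "norm (gauss_sum p g z (int g ^ i)) = norm (gauss_sum p g z 1)"
proof (induction i)
  case (Suc i)
  have "norm (gauss_sum p g z (int g ^ i * int g)) = norm (gauss_sum p g z (int g ^ i))"
    using arg_cong[OF gauss_sum_mult_primroot[OF assms(1), of "int g ^ i"], of norm] assms(2)
    by (simp add: norm_mult)
  with Suc show ?case by (simp add: mult_ac)
qed simp

text \<open>Expand the square and sum over \<open>n\<close> first. By orthogonality only the
  \<open>p - 1\<close> diagonal terms survive, and each contributes \<open>p\<close> because
  \<open>z ^ j\<close> has modulus 1.\<close>

lemma parseval_gauss_sum:
  assumes "norm z = 1"
  shows "(\<Sum>n<p. norm (gauss_sum p g z (int n)) ^ 2) = real p * real (p - 1)"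
proof -
  have z: "z ^ j * cnj z ^ j = 1" for j
    using assms by (simp flip: power_mult_distrib add: complex_norm_square[symmetric])
  have "complex_of_real (\<Sum>n<p. norm (gauss_sum p g z (int n)) ^ 2)
      = (\<Sum>n<p. gauss_sum p g z (int n) * cnj (gauss_sum p g z (int n)))"
    by (simp only: of_real_sum complex_norm_square)
  also have "\<dots> = (\<Sum>n<p. \<Sum>j<p - 1. \<Sum>i<p - 1.
      z ^ j * cnj z ^ i * unit_root p (int n * (int g ^ j - int g ^ i)))"
  proof (intro sum.cong refl)
    fix n
    have "unit_root p (int n * (int g ^ j - int g ^ i))
        = unit_root p (int n * int g ^ j) * cnj (unit_root p (int n * int g ^ i))" for i j
      by (simp add: cnj_unit_root right_diff_distrib flip: unit_root_add)
    then show "gauss_sum p g z (int n) * cnj (gauss_sum p g z (int n)) = (\<Sum>j<p - 1. \<Sum>i<p - 1.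
        z ^ j * cnj z ^ i * unit_root p (int n * (int g ^ j - int g ^ i)))"
      by (simp add: gauss_sum_def sum_product mult_ac)
  qed
  also have "\<dots> = (\<Sum>j<p - 1. \<Sum>n<p. \<Sum>i<p - 1.
      z ^ j * cnj z ^ i * unit_root p (int n * (int g ^ j - int g ^ i)))"
    by (rule sum.swap)
  also have "\<dots> = (\<Sum>j<p - 1. \<Sum>i<p - 1. \<Sum>n<p.
      z ^ j * cnj z ^ i * unit_root p (int n * (int g ^ j - int g ^ i)))"
    by (intro sum.cong refl sum.swap)
  also have "\<dots> = (\<Sum>j<p - 1. \<Sum>i<p - 1. if i = j then of_nat p else 0)"
  proof (intro sum.cong refl)
    fix j i assume "j \<in> {..<p - 1}" "i \<in> {..<p - 1}"
    then have "int p dvd int g ^ j - int g ^ i \<longleftrightarrow> i = j"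
      using primroot_power_cong_iff[of j i] by (auto simp: cong_iff_dvd_diff cong_def)
    then show "(\<Sum>n<p. z ^ j * cnj z ^ i * unit_root p (int n * (int g ^ j - int g ^ i)))
        = (if i = j then of_nat p else 0)"
      using z by (simp add: sum_unit_root[OF p_pos] flip: sum_distrib_left)
  qed
  also have "\<dots> = of_real (real p * real (p - 1))"
    by simp
  finally show ?thesis
    by (simp only: of_real_eq_iff)
qed

text \<open>In Parseval's identity the term at 0 vanishes and the other \<open>p - 1\<close> terms
  agree, so each squared modulus is exactly \<open>p\<close>. The inequality also covers the
  multiples of \<open>p\<close>, where the sum is zero.\<close>

lemma norm_gauss_sum_le:
  assumes "z ^ (p - 1) = 1" "z \<noteq> 1" "norm z = 1"
  shows "norm (gauss_sum p g z n) \<le> sqrt (real p)"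
proof (cases "int p dvd n")
  case True
  then show ?thesis using assms gauss_sum_dvd[OF p_pos] by simp
next
  case False
  have norm_eq: "norm (gauss_sum p g z k) = norm (gauss_sum p g z 1)" if "\<not> int p dvd k" for k
    using ex_primroot_power_cong[OF that] gauss_sum_cong[OF p_pos]
      norm_gauss_sum_primroot_power[OF assms(1,3)] by metis
  have "real p * real (p - 1) = (\<Sum>n<p. norm (gauss_sum p g z (int n)) ^ 2)"
    using parseval_gauss_sum[OF assms(3)] by simp
  also have "\<dots> = (\<Sum>n\<in>{..<p} - {0}. norm (gauss_sum p g z (int n)) ^ 2)"
    using p_pos gauss_sum_dvd[OF p_pos assms(1,2), of 0] by (subst sum.remove[of _ 0]) auto
  also have "\<dots> = (\<Sum>n\<in>{..<p} - {0}. norm (gauss_sum p g z 1) ^ 2)"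
    by (intro sum.cong refl arg_cong[where f = "\<lambda>x. x ^ 2"] norm_eq) (auto dest: dvd_imp_le)
  also have "\<dots> = norm (gauss_sum p g z 1) ^ 2 * real (p - 1)"
    using p_pos by simp
  finally have "norm (gauss_sum p g z 1) ^ 2 = real p"
    using prime_gt_1_nat[OF p] by simp
  then have "norm (gauss_sum p g z 1) = sqrt (real p)"
    by (metis norm_ge_zero real_sqrt_unique)
  with norm_eq[OF False] show ?thesis by simp
qed

section \<open>Power residues as powers of a primitive root\<close>

lemma power_residues_eq_primroot_powers:
  assumes "m > 0" "m dvd p - 1"
  shows "power_residues m p = (\<lambda>j. int (g ^ j mod p)) ` {j \<in> {..<p - 1}. m dvd j}"
proof (intro equalityI subsetI)
  fix k assume "k \<in> power_residues m p"
  then obtain x where k: "1 \<le> k" "k \<le> int p - 1" and x: "[k = x ^ m] (mod int p)"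
    by (auto simp: power_residues_def)
  have k_ndvd: "\<not> int p dvd k"
    using k by (auto dest: zdvd_imp_le)
  \<comment> \<open>Otherwise \<open>p\<close> would divide \<open>x ^ m\<close>, as
    \<open>m > 0\<close>, and hence \<open>k\<close>.\<close>
  then have "\<not> int p dvd x"
    using x assms(1) by (metis cong_dvd_iff dvd_power dvd_trans)
  then obtain i where "[x = int g ^ i] (mod int p)"
    by (rule ex_primroot_power_cong)
  then have "[x ^ m = (int g ^ i) ^ m] (mod int p)"
    by (rule cong_pow)
  then have k_cong: "[k = int g ^ (i * m)] (mod int p)"
    using x by (auto simp: power_mult intro: cong_trans)
  obtain j where j: "j < p - 1" "[k = int g ^ j] (mod int p)"
    using k_ndvd by (rule ex_primroot_power_cong)
  then have "[int g ^ j = int g ^ (i * m)] (mod int p)"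
    using k_cong cong_sym cong_trans by blast
  then have "[j = i * m] (mod (p - 1))"
    by (simp only: primroot_power_cong_iff)
  \<comment> \<open>Exponents are determined only modulo \<open>p - 1\<close>; since
    \<open>m\<close> divides \<open>p - 1\<close>, divisibility by \<open>m\<close> survives this
    ambiguity.\<close>
  then have "m dvd j"
    using assms(2) by (metis cong_dvd_iff cong_dvd_modulus_nat dvd_triv_right)
  moreover have "k = int (g ^ j mod p)"
    using j(2) k by (simp add: cong_def of_nat_mod)
  ultimately show "k \<in> (\<lambda>j. int (g ^ j mod p)) ` {j \<in> {..<p - 1}. m dvd j}"
    using j(1) by auto
next
  fix k assume "k \<in> (\<lambda>j. int (g ^ j mod p)) ` {j \<in> {..<p - 1}. m dvd j}"
  then obtain j where j: "j < p - 1" "m dvd j" "k = int (g ^ j mod p)"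
    by auto
  then obtain i where i: "j = m * i" by auto
  have "g ^ j mod p \<in> {1..p - 1}"
    using bij_betwE[OF bij_betw_primroot_powers] j(1) by blast
  moreover have "[k = (int g ^ i) ^ m] (mod int p)"
    using j(3) i by (simp add: cong_def of_nat_mod power_mult[symmetric] mult.commute)
  ultimately show "k \<in> power_residues m p"
    using j(3) by (auto simp: power_residues_def)
qed

end

section \<open>Character expansion of the weights and the final estimate\<close>

lemma dvd_indicator_minus_mean:
  assumes "m > 0"
  shows "(if m dvd j then 1 else 0) - 1 / complex_of_nat m
       = 1 / of_nat m * (\<Sum>r\<in>{1..<m}. unit_root m (int r) ^ j)"
proof -
  \<comment> \<open>The subtracted 1 is the term \<open>r = 0\<close>, the trivial character; after
    division by \<open>m\<close> it accounts for the mean.\<close>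
  have "(\<Sum>r\<in>{1..<m}. unit_root m (int r) ^ j) = (\<Sum>r<m. unit_root m (int r * int j)) - 1"
    using assms by (simp add: unit_root_power mult.commute lessThan_atLeast0 sum.atLeast_Suc_lessThan)
  also have "\<dots> = (if m dvd j then of_nat m else 0) - 1"
    using assms by (simp add: sum_unit_root)
  finally show ?thesis
    using assms by (simp add: field_simps)
qed

theorem theorem1:
  fixes m p :: nat and f :: "real \<Rightarrow> real"
  assumes "m > 1"
    and "prime p"
    and "[p = 1] (mod m)"
    and "f absolutely_integrable_on {0..1}"
    and "\<And>x. 0 < x \<Longrightarrow> x < 1 \<Longrightarrow>
           (\<lambda>N. fourier_partial_sum f N x) \<longlonglongrightarrow> complex_of_real (f x)"
    and "(\<lambda>n. norm (fourier_coeff f n)) summable_on (- {0})"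
  shows "\<bar>(\<Sum>k\<in>power_residues m p. f (real_of_int k / real p))
            - 1 / real m * (\<Sum>k = 1..p - 1. f (real k / real p))\<bar>
         \<le> (1 - 1 / real m) * fourier_S f * sqrt (real p)"
proof -
  obtain g where g: "residue_primroot p g"
    using prime_primitive_root_exists[OF prime_gt_1_nat[OF assms(2)] assms(2)] by blast
  have p_pos: "p > 0" using assms(2) by (rule prime_gt_0_nat)
  have m_dvd: "m dvd p - 1"
    using assms(3) p_pos by (simp add: cong_altdef_nat cong_sym_eq)
  note bij = bij_betw_primroot_powers[OF assms(2) g]
  \<comment> \<open>In terms of exponents the left-hand side is one sum of the values
    \<open>f (x j)\<close> with weights \<open>w j\<close>. Then \<open>W n\<close> is what the
    frequency \<open>n\<close> contributes per unit of its coefficient, and \<open>B\<close> will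
    bound it uniformly in \<open>n\<close>.\<close>
  define w where "w j = (if m dvd j then 1 else 0) - 1 / real m" for j
  define x where "x j = real (g ^ j mod p) / real p" for j
  define W where "W n = (\<Sum>j<p - 1. of_real (w j) * unit_root p (n * int g ^ j))" for n
  define B where "B = (1 - 1 / real m) * sqrt (real p)"
  have B_nonneg: "B \<ge> 0" using assms(1) by (simp add: B_def)

  have "(\<Sum>k\<in>power_residues m p. f (real_of_int k / real p))
      = (\<Sum>j | j \<in> {..<p - 1} \<and> m dvd j. f (x j))"
  proof -
    have "inj_on (\<lambda>j. int (g ^ j mod p)) {j \<in> {..<p - 1}. m dvd j}"
      using bij_betw_imp_inj_on[OF bij] by (auto simp: inj_on_def)
    then show ?thesis
      using assms(1) m_dvd
      by (simp add: power_residues_eq_primroot_powers[OF assms(2) g] sum.reindex x_def)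
  qed
  also have "\<dots> = (\<Sum>j<p - 1. if m dvd j then f (x j) else 0)"
    by (rule sum.inter_filter) simp
  also have "\<dots> - 1 / real m * (\<Sum>k = 1..p - 1. f (real k / real p)) = (\<Sum>j<p - 1. w j * f (x j))"
    unfolding sum.reindex_bij_betw[OF bij, of "\<lambda>k. f (real k / real p)", symmetric]
      sum_distrib_left sum_subtractf[symmetric]
    by (intro sum.cong) (auto simp: w_def x_def algebra_simps)
  finally have lhs: "(\<Sum>k\<in>power_residues m p. f (real_of_int k / real p))
      - 1 / real m * (\<Sum>k = 1..p - 1. f (real k / real p)) = (\<Sum>j<p - 1. w j * f (x j))" .

  have exp_eq: "exp (2 * of_real pi * \<i> * of_int n * of_real (x j)) = unit_root p (n * int g ^ j)"
    for n j
  proof -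
    have "exp (2 * of_real pi * \<i> * of_int n * of_real (x j)) = unit_root p (n * int (g ^ j mod p))"
      by (simp add: unit_root_def cis_conv_exp x_def mult_ac)
    also have "\<dots> = unit_root p (n * int g ^ j)"
      using p_pos by (intro unit_root_cong cong_mult) (auto simp: cong_def of_nat_mod)
    finally show ?thesis .
  qed

  \<comment> \<open>Convergence is assumed only on the open interval, so each sample point
    \<open>x j\<close> must avoid both endpoints; this holds because \<open>g ^ j mod p\<close> lies
    between 1 and \<open>p - 1\<close>.\<close>
  have "(\<lambda>N. \<Sum>j<p - 1. of_real (w j) * fourier_partial_sum f N (x j))
      \<longlonglongrightarrow> (\<Sum>j<p - 1. of_real (w j) * complex_of_real (f (x j)))"
  proof (intro tendsto_sum tendsto_mult tendsto_const assms(5))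
    fix j assume "j \<in> {..<p - 1}"
    then have "g ^ j mod p \<in> {1..p - 1}"
      by (rule bij_betwE[OF bij, rule_format])
    then show "0 < x j" "x j < 1"
      using p_pos by (auto simp: x_def)
  qed
  also have "(\<lambda>N. \<Sum>j<p - 1. of_real (w j) * fourier_partial_sum f N (x j))
      = (\<lambda>N. \<Sum>n = - int N..int N. fourier_coeff f n * W n)"
    unfolding fourier_partial_sum_def exp_eq W_def sum_distrib_left
    by (subst sum.swap) (simp add: mult_ac)
  finally have lim: "(\<lambda>N. \<Sum>n = - int N..int N. fourier_coeff f n * W n)
      \<longlonglongrightarrow> of_real (\<Sum>j<p - 1. w j * f (x j))"
    by simp

  have W_gauss: "W n = 1 / of_nat m * (\<Sum>r\<in>{1..<m}. gauss_sum p g (unit_root m (int r)) n)" for n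
  proof -
    have "complex_of_real (w j) = 1 / of_nat m * (\<Sum>r\<in>{1..<m}. unit_root m (int r) ^ j)" for j
      using dvd_indicator_minus_mean[of m j] assms(1) by (simp add: w_def split: if_splits)
    then show ?thesis
      unfolding W_def gauss_sum_def
      by (subst sum.swap) (simp add: sum_distrib_left sum_distrib_right mult_ac)
  qed
  \<comment> \<open>The first equation uses \<open>m dvd p - 1\<close>; nontriviality uses
    \<open>0 < r < m\<close>.\<close>
  have char: "unit_root m (int r) ^ (p - 1) = 1" "unit_root m (int r) \<noteq> 1" if "r \<in> {1..<m}" for r
    using that m_dvd assms(1) by (auto simp: unit_root_power unit_root_eq_1_iff dest: dvd_imp_le)
  \<comment> \<open>This removes the constant coefficient, which \<open>fourier_S f\<close> does not
    control.\<close>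
  have W_0: "W 0 = 0"
    using char p_pos by (simp add: W_gauss gauss_sum_dvd)
  have W_le: "norm (W n) \<le> B" for n
  proof -
    have "norm (W n) \<le> 1 / real m * (\<Sum>r\<in>{1..<m}. norm (gauss_sum p g (unit_root m (int r)) n))"
      unfolding W_gauss by (simp add: norm_mult norm_divide divide_right_mono norm_sum)
    also have "\<dots> \<le> 1 / real m * (\<Sum>r\<in>{1..<m}. sqrt (real p))"
      by (intro mult_left_mono sum_mono norm_gauss_sum_le[OF assms(2) g] char) auto
    \<comment> \<open>There are \<open>m - 1\<close> Gauss sums, which is the source of the factor
      \<open>1 - 1 / real m\<close>.\<close>
    also have "\<dots> = B"
      using assms(1) by (simp add: B_def of_nat_diff field_simps)
    finally show ?thesis .
  qed

  have "norm (\<Sum>n = - int N..int N. fourier_coeff f n * W n) \<le> fourier_S f * B" for N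
  proof -
    have "(\<Sum>n = - int N..int N. fourier_coeff f n * W n)
        = (\<Sum>n\<in>{- int N..int N} - {0}. fourier_coeff f n * W n)"
      by (intro sum.mono_neutral_right) (auto simp: W_0)
    also have "norm \<dots> \<le> (\<Sum>n\<in>{- int N..int N} - {0}. norm (fourier_coeff f n) * B)"
      by (intro sum_norm_le) (simp add: norm_mult mult_left_mono W_le)
    also have "\<dots> = (\<Sum>n\<in>{- int N..int N} - {0}. norm (fourier_coeff f n)) * B"
      by (simp add: sum_distrib_right)
    also have "\<dots> \<le> fourier_S f * B"
      unfolding fourier_S_def
      by (intro mult_right_mono finite_sum_le_infsum assms(6) B_nonneg) auto
    finally show ?thesis .
  qed
  \<comment> \<open>The bound on the symmetric partial sums does not depend on \<open>N\<close>, so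
    it passes to the limit.\<close>
  then have "norm (complex_of_real (\<Sum>j<p - 1. w j * f (x j))) \<le> fourier_S f * B"
    by (intro tendsto_upperbound[OF tendsto_norm[OF lim]]) auto
  then show ?thesis
    unfolding lhs norm_of_real B_def by (simp add: mult_ac)
qed

end
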